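(* Let $G$ be a topological group, and let $\mathfrak{E}:\mathbb{G}(G)\to\mathbb{E}(G)$, $\mathfrak{E}(bG)=\mathrm{cl}(\imath_{bG}(G))$, be the Ellis map. Then: \begin{itemize} \item $\mathfrak{E}$ is an epimorphism of posets (an order-preserving surjection); \item $\mathfrak{E}(bG)\geq bG$ for every $bG\in\mathbb{G}(G)$; \item $\mathfrak{E}\circ\mathfrak{E}=\mathfrak{E}$. \end{itemize}
   Context: All spaces are Tychonoff. A compactification of a space $X$ is a pair $(bX,b)$ with $bX$ compact (Hausdorff) and $b:X\to bX$ a topological embedding with dense image. Write $b'X\geq bX$ if there is a continuous map $f:b'X\to bX$ with $b=f\circ b'$ ($f$ is the map of compactifications); compactifications are identified when each is $\geq$ the other. Let $G$ be a topological group and $\alpha(g,h)=gh$ the left action of $G$ on itself. A $G$-compactification of $G$ is a compactification $(bG,b)$ together with a continuous left action $\tilde\alpha:G\times bG\to bG$ such that $\tilde\alpha(g,b(h))=b(gh)$ for all $g,h\in G$; $G$ is identified with $b(G)$. $\mathbb{G}(G)$ is the poset of $G$-compactifications of $G$. A right topological monoid is a monoid $(S,\bullet)$ on a topological space such that for each $s\in S$ the map $x\mapsto x\bullet s$ is continuous. An Ellis compactification of $G$ is a $G$-compactification $bG$ that carries a multiplication $\bullet$ making it a right topological monoid with $\bullet|_{G\times bG}=\tilde\alpha$. $\mathbb{E}(G)\subset\mathbb{G}(G)$ is the poset of Ellis compactifications, with the induced order. For $bG\in\mathbb{G}(G)$, let $\imath_{bG}:G\to(bG)^{bG}$, $\imath_{bG}(g)(x)=\tilde\alpha(g,x)$,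 where $(bG)^{bG}$ is the set of all self-maps of $bG$ with the product (Tychonoff) topology and composition as multiplication. The map $\imath_{bG}$ is a topological embedding, and $\mathrm{cl}(\imath_{bG}(G))$, the closure in $(bG)^{bG}$, with embedding $\imath_{bG}$, is an Ellis compactification of $G$; this defines $\mathfrak{E}$. *)

theory Defs
  imports "HOL-Analysis.Analysis" "HOL-Algebra.Group_Action"
begin

definition tychonoff_space :: "'a topology \<Rightarrow> bool" where
  "tychonoff_space X \<longleftrightarrow> Hausdorff_space X \<and> completely_regular_space X"

locale topological_group = group G for G (structure) +
  fixes T :: "'a topology"
  assumes topspace_eq: "topspace T = carrier G"
    and continuous_mult: "continuous_map (prod_topology T T) T (\<lambda>(x, y). x \<otimes> y)"
    and continuous_inv: "continuous_map T T (\<lambda>x. inv x)"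

definition compactification :: "'a topology \<Rightarrow> 'b topology \<Rightarrow> ('a \<Rightarrow> 'b) \<Rightarrow> bool" where
  "compactification X B b \<longleftrightarrow>
     compact_space B \<and> Hausdorff_space B \<and> embedding_map X B b \<and>
     B closure_of (b ` topspace X) = topspace B"

text \<open>The data of a compactification of a group of type \<open>'a\<close> together with an action on it.\<close>

record ('a, 'b) gcomp =
  gspace :: "'b topology"
  gemb :: "'a \<Rightarrow> 'b"
  gact :: "'a \<Rightarrow> 'b \<Rightarrow> 'b"

text \<open>The library's \<open>group_action\<close> normalises each \<open>gact bG g\<close>, for \<open>g\<close> in the carrier, to be
  \<open>undefined\<close> outside the underlying set of the space acted upon.\<close>

definition G_compactification ::
    "('a, 'm) monoid_scheme \<Rightarrow> 'a topology \<Rightarrow> ('a, 'b) gcomp \<Rightarrow> bool" where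
  "G_compactification G T bG \<longleftrightarrow>
     compactification T (gspace bG) (gemb bG) \<and>
     group_action G (topspace (gspace bG)) (gact bG) \<and>
     continuous_map (prod_topology T (gspace bG)) (gspace bG) (\<lambda>(g, x). gact bG g x) \<and>
     (\<forall>g\<in>carrier G. \<forall>h\<in>carrier G. gact bG g (gemb bG h) = gemb bG (g \<otimes>\<^bsub>G\<^esub> h))"

definition right_topological_monoid :: "('b, 'm) monoid_scheme \<Rightarrow> 'b topology \<Rightarrow> bool" where
  "right_topological_monoid S B \<longleftrightarrow>
     monoid S \<and> carrier S = topspace B \<and>
     (\<forall>s\<in>carrier S. continuous_map B B (\<lambda>x. x \<otimes>\<^bsub>S\<^esub> s))"

definition Ellis_compactification ::
    "('a, 'm) monoid_scheme \<Rightarrow> 'a topology \<Rightarrow> ('a, 'b) gcomp \<Rightarrow> bool" where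
  "Ellis_compactification G T bG \<longleftrightarrow>
     G_compactification G T bG \<and>
     (\<exists>S :: 'b monoid. right_topological_monoid S (gspace bG) \<and>
        (\<forall>g\<in>carrier G. \<forall>x\<in>topspace (gspace bG). gemb bG g \<otimes>\<^bsub>S\<^esub> x = gact bG g x))"

text \<open>\<open>comp_ge G b'G bG\<close> is \<open>b'G \<ge> bG\<close> in the order of compactifications of \<open>G\<close>. The two
  compactifications may live on different types, and the poset of \<open>G\<close>-compactifications is this
  preorder with \<open>comp_eq\<close> as its equality.\<close>

definition comp_ge ::
    "('a, 'm) monoid_scheme \<Rightarrow> ('a, 'b) gcomp \<Rightarrow> ('a, 'c) gcomp \<Rightarrow> bool" where
  "comp_ge G b'G bG \<longleftrightarrow>
     (\<exists>f. continuous_map (gspace b'G) (gspace bG) f \<and>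
        (\<forall>g\<in>carrier G. gemb bG g = f (gemb b'G g)))"

definition comp_eq ::
    "('a, 'm) monoid_scheme \<Rightarrow> ('a, 'b) gcomp \<Rightarrow> ('a, 'c) gcomp \<Rightarrow> bool" where
  "comp_eq G b'G bG \<longleftrightarrow> comp_ge G b'G bG \<and> comp_ge G bG b'G"

lemma comp_ge_refl: "comp_ge G bG bG"
  unfolding comp_ge_def by (rule exI[of _ "\<lambda>x. x"]) simp

lemma comp_ge_trans:
  assumes "comp_ge G cG bG" "comp_ge G bG aG"
  shows "comp_ge G cG aG"
proof -
  obtain f where f: "continuous_map (gspace cG) (gspace bG) f"
      "\<forall>g\<in>carrier G. gemb bG g = f (gemb cG g)"
    using assms(1) unfolding comp_ge_def by blast
  obtain h where h: "continuous_map (gspace bG) (gspace aG) h"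
      "\<forall>g\<in>carrier G. gemb aG g = h (gemb bG g)"
    using assms(2) unfolding comp_ge_def by blast
  have "continuous_map (gspace cG) (gspace aG) (h \<circ> f)"
    using f(1) h(1) by (rule continuous_map_compose)
  moreover have "\<forall>g\<in>carrier G. gemb aG g = (h \<circ> f) (gemb cG g)"
    using f(2) h(2) by simp
  ultimately show ?thesis
    unfolding comp_ge_def by blast
qed

text \<open>Self-maps of a space are represented as extensional functions on its underlying set, the
  points of \<open>product_topology\<close>; correspondingly their composition is \<open>compose\<close>.\<close>

definition self_map_topology :: "'b topology \<Rightarrow> ('b \<Rightarrow> 'b) topology" where
  "self_map_topology B = product_topology (\<lambda>_. B) (topspace B)"

definition ellis_emb :: "('a, 'b) gcomp \<Rightarrow> 'a \<Rightarrow> 'b \<Rightarrow> 'b" where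
  "ellis_emb bG g = (\<lambda>x\<in>topspace (gspace bG). gact bG g x)"

definition ellis_set :: "('a, 'm) monoid_scheme \<Rightarrow> ('a, 'b) gcomp \<Rightarrow> ('b \<Rightarrow> 'b) set" where
  "ellis_set G bG = self_map_topology (gspace bG) closure_of (ellis_emb bG ` carrier G)"

text \<open>The action of \<open>G\<close> on the closure is the one an Ellis compactification must have, namely
  multiplication, i.e. composition, by the image of \<open>G\<close> on the left.\<close>

definition ellis_map ::
    "('a, 'm) monoid_scheme \<Rightarrow> ('a, 'b) gcomp \<Rightarrow> ('a, 'b \<Rightarrow> 'b) gcomp" where
  "ellis_map G bG =
     \<lparr>gspace = subtopology (self_map_topology (gspace bG)) (ellis_set G bG),
      gemb = ellis_emb bG,
      gact = (\<lambda>g. \<lambda>p\<in>ellis_set G bG. compose (topspace (gspace bG)) (ellis_emb bG g) p)\<rparr>"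

end

theory Submission
  imports Defs
begin

text \<open>The closure of \<open>\<iota>(G)\<close> is closed under composition because \<open>p \<mapsto> \<iota>(g) \<circ> p\<close> and
  \<open>p \<mapsto> p \<circ> q\<close> are continuous on the space of all self-maps: first move \<open>p\<close> to the closure with
  \<open>g\<close> fixed, then move \<open>\<iota>(g)\<close> to the closure with \<open>q\<close> fixed. Evaluation at the image of \<open>\<one>\<close>
  is the map of compactifications onto \<open>bG\<close>; it also shows that \<open>\<iota>\<close> is an embedding. When \<open>bG\<close> is
  itself an Ellis compactification, \<open>s \<mapsto> (x \<mapsto> s \<bullet> x)\<close> is continuous by right
  continuity and extends \<open>\<iota>\<close>, so \<open>bG\<close> and its image under the Ellis map are equal; this gives both
  surjectivity and idempotence.\<close>

section \<open>Embeddings and closures under continuous maps\<close>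

lemma embedding_map_if_compose:
  assumes f: "continuous_map X Y f" and g: "continuous_map Y Z g"
    and "embedding_map X Z (g \<circ> f)"
  shows "embedding_map X Y f"
proof -
  obtain k where k: "continuous_map (subtopology Z ((g \<circ> f) ` topspace X)) X k"
      "\<And>x. x \<in> topspace X \<Longrightarrow> k (g (f x)) = x"
    using assms(3) unfolding embedding_map_def homeomorphic_map_maps homeomorphic_maps_def by auto
  have "continuous_map (subtopology Y (f ` topspace X)) (subtopology Z ((g \<circ> f) ` topspace X)) g"
    using g by (auto simp: continuous_map_in_subtopology continuous_map_from_subtopology)
  then have "continuous_map (subtopology Y (f ` topspace X)) X (k \<circ> g)"
    using k(1) by (rule continuous_map_compose)
  then have "homeomorphic_maps X (subtopology Y (f ` topspace X)) f (k \<circ> g)"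
    using f k(2) by (auto simp: homeomorphic_maps_def continuous_map_in_subtopology)
  then show ?thesis
    unfolding embedding_map_def homeomorphic_map_maps by blast
qed

text \<open>Reduces every claim that a continuous map sends the closure of \<open>\<iota>(G)\<close>
  into a closed set to a check on \<open>\<iota>(G)\<close> alone; the closed set will be the
  closure of some image of the group.\<close>

lemma continuous_map_closure_subset:
  assumes "continuous_map X Y f" "f ` S \<subseteq> C" "closedin Y C"
  shows "f ` (X closure_of S) \<subseteq> C"
  by (meson assms closure_of_minimal continuous_map_image_closure_subset order_trans)

section \<open>The space of self-maps with the product topology\<close>

lemma topspace_self_map_topology:
  "topspace (self_map_topology B) = (topspace B \<rightarrow>\<^sub>E topspace B)"
  by (simp add: self_map_topology_def)

lemma continuous_map_into_self_map_topology:
  assumes "\<And>z. z \<in> topspace Z \<Longrightarrow> f z \<in> extensional (topspace B)"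
    and "\<And>x. x \<in> topspace B \<Longrightarrow> continuous_map Z B (\<lambda>z. f z x)"
  shows "continuous_map Z (self_map_topology B) f"
  using assms unfolding self_map_topology_def continuous_map_componentwise by auto

lemma continuous_map_self_map_eval:
  "x \<in> topspace B \<Longrightarrow> continuous_map (self_map_topology B) B (\<lambda>p. p x)"
  unfolding self_map_topology_def by (rule continuous_map_product_projection)

text \<open>The coordinate at \<open>x\<close> of the composite is \<open>p (q x)\<close>, which as
  a function of \<open>p\<close> is evaluation at the fixed point \<open>q x\<close>. This works for
  every self-map \<open>q\<close>, continuous or not.\<close>

lemma continuous_map_compose_right:
  assumes "q \<in> topspace (self_map_topology B)"
  shows "continuous_map (self_map_topology B) (self_map_topology B)
    (\<lambda>p. compose (topspace B) p q)"
proof (rule continuous_map_into_self_map_topology)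
  fix x assume "x \<in> topspace B"
  then show "continuous_map (self_map_topology B) B (\<lambda>p. compose (topspace B) p q x)"
    using assms
    by (auto simp: compose_eq topspace_self_map_topology intro!: continuous_map_self_map_eval)
qed simp

section \<open>A fixed G-compactification and the map of G into its self-maps\<close>

locale G_compactified_group = topological_group +
  fixes bG :: "('a, 'c) gcomp"
  assumes G_compactification: "G_compactification G T bG"
begin

abbreviation "B \<equiv> gspace bG"
abbreviation "P \<equiv> self_map_topology B"
abbreviation "E \<equiv> ellis_set G bG"
abbreviation "\<iota> \<equiv> ellis_emb bG"

lemma compactification: "compactification T B (gemb bG)"
  and continuous_act: "continuous_map (prod_topology T B) B (\<lambda>(g, x). gact bG g x)"
  and act_emb: "\<lbrakk>g \<in> carrier G; h \<in> carrier G\<rbrakk> \<Longrightarrow> gact bG g (gemb bG h) = gemb bG (g \<otimes> h)"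
  using G_compactification unfolding G_compactification_def by auto

sublocale action: group_action G "topspace B" "gact bG"
  using G_compactification unfolding G_compactification_def by blast

lemma compact_space: "compact_space B"
  and Hausdorff_space: "Hausdorff_space B"
  and embedding_emb: "embedding_map T B (gemb bG)"
  and dense_emb: "B closure_of (gemb bG ` carrier G) = topspace B"
  using compactification unfolding compactification_def by (auto simp: topspace_eq)

lemma emb_closed: "g \<in> carrier G \<Longrightarrow> gemb bG g \<in> topspace B"
  using embedding_emb topspace_eq
  by (metis embedding_map_def homeomorphic_imp_continuous_map continuous_map_in_subtopology
      continuous_map_image_subset_topspace image_subset_iff)

lemma act_closed: "\<lbrakk>g \<in> carrier G; x \<in> topspace B\<rbrakk> \<Longrightarrow> gact bG g x \<in> topspace B"
  using action.element_image by blast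

lemma act_one: "x \<in> topspace B \<Longrightarrow> gact bG \<one> x = x"
  by (metis action.id_eq_one restrict_apply')

lemma continuous_act_left:
  assumes "x \<in> topspace B" shows "continuous_map T B (\<lambda>g. gact bG g x)"
proof -
  have "continuous_map T (prod_topology T B) (\<lambda>g. (g, x))"
    using assms by (simp add: continuous_map_paired)
  from continuous_map_compose[OF this continuous_act] show ?thesis
    by (simp add: o_def)
qed

lemma continuous_act_right:
  assumes "g \<in> carrier G" shows "continuous_map B B (gact bG g)"
proof -
  have "continuous_map B (prod_topology T B) (\<lambda>x. (g, x))"
    using assms by (simp add: continuous_map_paired topspace_eq)
  from continuous_map_compose[OF this continuous_act] show ?thesis
    by (simp add: o_def)
qed

lemma ellis_emb_apply: "x \<in> topspace B \<Longrightarrow> \<iota> g x = gact bG g x"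
  by (simp add: ellis_emb_def)

lemma ellis_emb_in_topspace: "g \<in> carrier G \<Longrightarrow> \<iota> g \<in> topspace P"
  by (auto simp: ellis_emb_def topspace_self_map_topology act_closed)

lemma ellis_emb_one: "\<iota> \<one> = (\<lambda>x\<in>topspace B. x)"
  by (auto simp: ellis_emb_def act_one)

lemma ellis_emb_mult:
  assumes "g \<in> carrier G" "h \<in> carrier G"
  shows "\<iota> (g \<otimes> h) = compose (topspace B) (\<iota> g) (\<iota> h)"
  using assms by (auto simp: ellis_emb_def compose_def act_closed action.composition_rule)

lemma continuous_ellis_emb: "continuous_map T P \<iota>"
  by (rule continuous_map_into_self_map_topology)
    (auto simp: ellis_emb_def continuous_act_left)

lemma eval_one_ellis_emb: "g \<in> carrier G \<Longrightarrow> \<iota> g (gemb bG \<one>) = gemb bG g"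
  by (simp add: ellis_emb_apply emb_closed act_emb)

lemma embedding_ellis_emb: "embedding_map T P \<iota>"
proof (rule embedding_map_if_compose[OF continuous_ellis_emb])
  show "continuous_map P B (\<lambda>p. p (gemb bG \<one>))"
    by (simp add: continuous_map_self_map_eval emb_closed)
  show "embedding_map T B ((\<lambda>p. p (gemb bG \<one>)) \<circ> \<iota>)"
    using embedding_emb by (rule embedding_map_eq) (simp add: topspace_eq eval_one_ellis_emb)
qed

section \<open>The closure of the image of G and its stability under composition\<close>

lemma closedin_ellis_set: "closedin P E"
  by (simp add: ellis_set_def)

lemma ellis_set_subset: "E \<subseteq> topspace P"
  by (simp add: ellis_set_def closure_of_subset_topspace)

lemma ellis_setD: "p \<in> E \<Longrightarrow> p \<in> topspace B \<rightarrow>\<^sub>E topspace B"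
  using ellis_set_subset unfolding topspace_self_map_topology by blast

lemma ellis_emb_in_ellis_set: "g \<in> carrier G \<Longrightarrow> \<iota> g \<in> E"
  using closure_of_subset[of "\<iota> ` carrier G" P] ellis_emb_in_topspace
  by (auto simp: ellis_set_def)

text \<open>The coordinate at \<open>x\<close> factors as \<open>(g, p) \<mapsto> (g, p x)\<close>
  followed by the action on \<open>bG\<close>, so joint continuity of that action passes to the
  space of all self-maps. Fixing \<open>g\<close> gives continuity of left translation.\<close>

lemma continuous_ellis_act:
  "continuous_map (prod_topology T P) P (\<lambda>(g, p). compose (topspace B) (\<iota> g) p)"
proof (rule continuous_map_into_self_map_topology)
  fix x assume x: "x \<in> topspace B"
  have "continuous_map (prod_topology T P) (prod_topology T B) (\<lambda>z. (fst z, snd z x))"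
    using continuous_map_compose[OF continuous_map_snd continuous_map_self_map_eval[OF x], of T]
    by (intro continuous_map_pairedI) (simp_all add: continuous_map_fst o_def)
  from continuous_map_compose[OF this continuous_act]
  show "continuous_map (prod_topology T P) B
      (\<lambda>z. (case z of (g, p) \<Rightarrow> compose (topspace B) (\<iota> g) p) x)"
    by (rule continuous_map_eq)
      (use x in \<open>auto simp: compose_eq topspace_self_map_topology ellis_emb_apply PiE_iff\<close>)
qed auto

lemma ellis_act_closed:
  assumes g: "g \<in> carrier G" and p: "p \<in> E"
  shows "compose (topspace B) (\<iota> g) p \<in> E"
proof -
  have "continuous_map P (prod_topology T P) (\<lambda>p. (g, p))"
    using g by (simp add: continuous_map_paired topspace_eq)
  from continuous_map_compose[OF this continuous_ellis_act]
  have "continuous_map P P (compose (topspace B) (\<iota> g))"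
    by (simp add: o_def)
  moreover have "compose (topspace B) (\<iota> g) ` \<iota> ` carrier G \<subseteq> E"
    using g by (auto simp flip: ellis_emb_mult intro!: ellis_emb_in_ellis_set)
  ultimately have "compose (topspace B) (\<iota> g) ` (P closure_of (\<iota> ` carrier G)) \<subseteq> E"
    using closedin_ellis_set by (rule continuous_map_closure_subset)
  with p show ?thesis
    by (auto simp: ellis_set_def)
qed

lemma ellis_set_compose:
  assumes p: "p \<in> E" and q: "q \<in> E"
  shows "compose (topspace B) p q \<in> E"
proof -
  have "(\<lambda>p. compose (topspace B) p q) ` (P closure_of (\<iota> ` carrier G)) \<subseteq> E"
    using q ellis_set_subset
    by (intro continuous_map_closure_subset[OF continuous_map_compose_right _ closedin_ellis_set])
      (auto intro: ellis_act_closed)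
  with p show ?thesis
    by (auto simp: ellis_set_def)
qed

text \<open>The restriction built into \<open>compose\<close> respects associativity once the
  innermost map \<open>r\<close> sends the space into itself, which membership in the closure
  guarantees.\<close>

lemma ellis_set_assoc:
  assumes "p \<in> E" "q \<in> E" "r \<in> E"
  shows "compose (topspace B) (compose (topspace B) p q) r =
    compose (topspace B) p (compose (topspace B) q r)"
  using ellis_setD[OF assms(3)] by (intro compose_assoc[symmetric]) auto

section \<open>The closure as an Ellis compactification above the given one\<close>

lemma ellis_map_sel:
  "gspace (ellis_map G bG) = subtopology P E" "gemb (ellis_map G bG) = \<iota>"
  "gact (ellis_map G bG) = (\<lambda>g. \<lambda>p\<in>E. compose (topspace B) (\<iota> g) p)"
  by (simp_all add: ellis_map_def)

lemma topspace_ellis_map: "topspace (gspace (ellis_map G bG)) = E"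
  using ellis_set_subset by (auto simp: ellis_map_sel)

text \<open>A power of a compact Hausdorff space is compact Hausdorff, and both properties pass to
  the closed subset \<open>E\<close>. Density holds because closure within \<open>E\<close> is
  closure in the power intersected with \<open>E\<close>.\<close>

lemma ellis_map_compactification: "compactification T (gspace (ellis_map G bG)) \<iota>"
  unfolding compactification_def
proof (intro conjI)
  have P: "compact_space P" "Hausdorff_space P"
    using compact_space Hausdorff_space
    by (auto simp: self_map_topology_def compact_space_product_topology
        Hausdorff_space_product_topology)
  show "compact_space (gspace (ellis_map G bG))"
    using P(1) closedin_ellis_set
    by (simp add: ellis_map_sel closedin_compact_space compact_space_subtopology)
  show "Hausdorff_space (gspace (ellis_map G bG))"
    using P(2) by (simp add: ellis_map_sel Hausdorff_space_subtopology)
  show "embedding_map T (gspace (ellis_map G bG)) \<iota>"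
    using embedding_ellis_emb
    by (auto simp: ellis_map_sel embedding_map_in_subtopology topspace_eq ellis_emb_in_ellis_set)
  have "\<iota> ` carrier G \<subseteq> E"
    by (auto intro: ellis_emb_in_ellis_set)
  then show "gspace (ellis_map G bG) closure_of (\<iota> ` topspace T) =
      topspace (gspace (ellis_map G bG))"
    by (simp add: topspace_ellis_map topspace_eq)
      (simp add: ellis_map_sel closure_of_subtopology inf.absorb2 flip: ellis_set_def)
qed

text \<open>The target \<open>BijGroup E\<close> requires each translation to be an extensional
  bijection of \<open>E\<close>; translation by \<open>inv g\<close> is the two-sided
  inverse.\<close>

lemma ellis_map_group_action: "group_action G E (gact (ellis_map G bG))"
proof -
  let ?a = "gact (ellis_map G bG)"
  have one: "?a \<one> p = p" if "p \<in> E" for p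
    using that ellis_setD[OF that]
    by (simp add: ellis_map_sel ellis_emb_one Id_compose PiE_iff Pi_iff)
  have mult: "?a (g \<otimes> h) p = ?a g (?a h p)"
    if "g \<in> carrier G" "h \<in> carrier G" "p \<in> E" for g h p
    using that
    by (simp add: ellis_map_sel ellis_act_closed ellis_emb_mult ellis_set_assoc ellis_emb_in_ellis_set)
  have closed: "?a g p \<in> E" if "g \<in> carrier G" "p \<in> E" for g p
    using that by (simp add: ellis_map_sel ellis_act_closed)
  have Bij: "?a g \<in> Bij E" if g: "g \<in> carrier G" for g
  proof -
    have "bij_betw (?a g) E E"
    proof (rule bij_betw_byWitness)
      show "\<forall>p\<in>E. ?a (inv g) (?a g p) = p" "\<forall>p\<in>E. ?a g (?a (inv g) p) = p"
        using g one by (simp_all flip: mult)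
    qed (use g closed in auto)
    then show ?thesis
      by (simp add: Bij_def ellis_map_sel)
  qed
  have "?a \<in> hom G (BijGroup E)"
  proof (rule homI)
    fix g h assume gh: "g \<in> carrier G" "h \<in> carrier G"
    have "?a (g \<otimes> h) = compose E (?a g) (?a h)"
    proof
      \<comment> \<open>Outside \<open>E\<close> both sides are \<open>undefined\<close>, so the
        equality holds for functions and not only pointwise on \<open>E\<close>.\<close>
      fix p show "?a (g \<otimes> h) p = compose E (?a g) (?a h) p"
        using gh mult by (cases "p \<in> E") (auto simp: compose_def ellis_map_sel)
    qed
    then show "?a (g \<otimes> h) = ?a g \<otimes>\<^bsub>BijGroup E\<^esub> ?a h"
      using gh Bij by (simp add: BijGroup_def)
  qed (simp add: BijGroup_def Bij)
  then show ?thesis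
    by (simp add: group_action_def group_hom_def group_hom_axioms_def group_BijGroup is_group)
qed

text \<open>Joint continuity is inherited from all self-maps by restricting the domain, and the
  codomain by stability of \<open>E\<close> under left translation.\<close>

lemma ellis_map_G_compactification: "G_compactification G T (ellis_map G bG)"
  unfolding G_compactification_def topspace_ellis_map
proof (intro conjI ballI)
  show "compactification T (gspace (ellis_map G bG)) (gemb (ellis_map G bG))"
    using ellis_map_compactification by (simp add: ellis_map_sel)
  show "group_action G E (gact (ellis_map G bG))"
    by (rule ellis_map_group_action)
  have top: "topspace (prod_topology T (subtopology P E)) = carrier G \<times> E"
    using topspace_ellis_map by (simp add: ellis_map_sel topspace_eq)
  have "continuous_map (prod_topology T (subtopology P E)) P
      (\<lambda>(g, p). compose (topspace B) (\<iota> g) p)"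
    using continuous_ellis_act
    by (simp add: prod_topology_subtopology continuous_map_from_subtopology)
  then have "continuous_map (prod_topology T (subtopology P E)) (subtopology P E)
      (\<lambda>(g, p). compose (topspace B) (\<iota> g) p)"
    by (rule continuous_map_into_subtopology) (use top ellis_act_closed in auto)
  then have "continuous_map (prod_topology T (subtopology P E)) (subtopology P E)
      (\<lambda>(g, p). gact (ellis_map G bG) g p)"
    by (rule continuous_map_eq) (use top in \<open>auto simp: ellis_map_sel\<close>)
  then show "continuous_map (prod_topology T (gspace (ellis_map G bG))) (gspace (ellis_map G bG))
      (\<lambda>(g, p). gact (ellis_map G bG) g p)"
    by (simp add: ellis_map_sel)
  fix g h assume "g \<in> carrier G" "h \<in> carrier G"
  then show "gact (ellis_map G bG) g (gemb (ellis_map G bG) h) =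
      gemb (ellis_map G bG) (g \<otimes> h)"
    by (simp add: ellis_map_sel ellis_emb_in_ellis_set ellis_emb_mult)
qed

lemma ellis_map_Ellis_compactification: "Ellis_compactification G T (ellis_map G bG)"
proof -
  define S where
    "S = \<lparr>carrier = E, mult = compose (topspace B), one = (\<lambda>x\<in>topspace B. x)\<rparr>"
  have "monoid S"
  proof (rule monoidI)
    \<comment> \<open>The identity of the space lies in the closure because it is
      \<open>\<iota> \<one>\<close>.\<close>
    show "\<one>\<^bsub>S\<^esub> \<in> carrier S"
      using ellis_emb_in_ellis_set[OF one_closed] by (simp add: S_def ellis_emb_one)
    fix p assume "p \<in> carrier S"
    then have "p \<in> topspace B \<rightarrow>\<^sub>E topspace B"
      using ellis_setD by (simp add: S_def)
    then show "\<one>\<^bsub>S\<^esub> \<otimes>\<^bsub>S\<^esub> p = p" "p \<otimes>\<^bsub>S\<^esub> \<one>\<^bsub>S\<^esub> = p"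
      by (auto simp: S_def PiE_def intro!: Id_compose compose_Id)
  qed (simp_all add: S_def ellis_set_compose ellis_set_assoc)
  moreover have "continuous_map (subtopology P E) (subtopology P E) (\<lambda>p. compose (topspace B) p q)"
    if "q \<in> E" for q
    using that ellis_set_subset ellis_set_compose
    by (auto simp: continuous_map_in_subtopology
        intro!: continuous_map_from_subtopology continuous_map_compose_right)
  ultimately have "right_topological_monoid S (gspace (ellis_map G bG))"
    by (simp add: right_topological_monoid_def topspace_ellis_map)
      (simp add: S_def ellis_map_sel)
  moreover have "\<forall>g\<in>carrier G. \<forall>p\<in>topspace (gspace (ellis_map G bG)).
      gemb (ellis_map G bG) g \<otimes>\<^bsub>S\<^esub> p = gact (ellis_map G bG) g p"
    by (simp add: topspace_ellis_map) (simp add: S_def ellis_map_sel)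
  ultimately show ?thesis
    unfolding Ellis_compactification_def using ellis_map_G_compactification by blast
qed

lemma ellis_map_ge: "comp_ge G (ellis_map G bG) bG"
  unfolding comp_ge_def
proof (intro exI conjI ballI)
  show "continuous_map (gspace (ellis_map G bG)) B (\<lambda>p. p (gemb bG \<one>))"
    by (simp add: ellis_map_sel continuous_map_from_subtopology continuous_map_self_map_eval
        emb_closed)
qed (simp add: ellis_map_sel eval_one_ellis_emb)

section \<open>Maps of compactifications and monotonicity of the Ellis map\<close>

text \<open>Both sides are continuous in \<open>x\<close> with values in a Hausdorff space, and on
  the dense image of the group both take \<open>gemb b'G h\<close> to
  \<open>gemb bG (g \<otimes> h)\<close>.\<close>

lemma comp_ge_equivariant:
  assumes "G_compactification G T b'G"
    and f: "continuous_map (gspace b'G) B f"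
    and emb: "\<And>g. g \<in> carrier G \<Longrightarrow> gemb bG g = f (gemb b'G g)"
    and g: "g \<in> carrier G" and x: "x \<in> topspace (gspace b'G)"
  shows "f (gact b'G g x) = gact bG g (f x)"
proof -
  interpret b': G_compactified_group G T b'G
    using assms(1) by unfold_locales
  have "(f \<circ> gact b'G g) x = (gact bG g \<circ> f) x"
  proof (rule forall_in_closure_of_eq[where X = "gspace b'G" and S = "gemb b'G ` carrier G"])
    show "x \<in> gspace b'G closure_of (gemb b'G ` carrier G)"
      using x by (simp add: b'.dense_emb)
    show "continuous_map (gspace b'G) B (f \<circ> gact b'G g)"
      using b'.continuous_act_right[OF g] f by (rule continuous_map_compose)
    show "continuous_map (gspace b'G) B (gact bG g \<circ> f)"
      using f continuous_act_right[OF g] by (rule continuous_map_compose)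
    fix y assume "y \<in> gemb b'G ` carrier G"
    then show "(f \<circ> gact b'G g) y = (gact bG g \<circ> f) y"
      using g by (auto simp: b'.act_emb act_emb simp flip: emb)
  qed (rule Hausdorff_space)
  then show ?thesis by simp
qed

text \<open>The image is compact, hence closed, and contains the dense image of the group.
  Surjectivity supplies the section used for monotonicity.\<close>

lemma comp_ge_surj:
  assumes "G_compactification G T b'G"
    and f: "continuous_map (gspace b'G) B f"
    and emb: "\<And>g. g \<in> carrier G \<Longrightarrow> gemb bG g = f (gemb b'G g)"
  shows "f ` topspace (gspace b'G) = topspace B"
proof -
  interpret b': G_compactified_group G T b'G
    using assms(1) by unfold_locales
  have "compactin B (f ` topspace (gspace b'G))"
    using b'.compact_space f unfolding compact_space_def by (rule image_compactin)
  then have "closedin B (f ` topspace (gspace b'G))"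
    by (rule compactin_imp_closedin[OF Hausdorff_space])
  moreover have "gemb bG ` carrier G \<subseteq> f ` topspace (gspace b'G)"
    by (auto simp: emb b'.emb_closed)
  ultimately have "topspace B \<subseteq> f ` topspace (gspace b'G)"
    using closure_of_minimal dense_emb by metis
  then show ?thesis
    using f by (simp add: continuous_map_image_subset_topspace subset_antisym)
qed

text \<open>A self-map \<open>p\<close> of the larger compactification is turned into one of the
  smaller by lifting a point along \<open>f\<close>, applying \<open>p\<close>, and projecting by
  \<open>f\<close>.\<close>

lemma ellis_map_mono:
  assumes b': "G_compactification G T b'G" and ge: "comp_ge G b'G bG"
  shows "comp_ge G (ellis_map G b'G) (ellis_map G bG)"
proof -
  interpret b': G_compactified_group G T b'G
    using b' by unfold_locales
  obtain f where f: "continuous_map (gspace b'G) B f"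
    and emb: "\<And>g. g \<in> carrier G \<Longrightarrow> gemb bG g = f (gemb b'G g)"
    using ge unfolding comp_ge_def by blast
  define s where "s = inv_into (topspace (gspace b'G)) f"
  have s: "s y \<in> topspace (gspace b'G)" "f (s y) = y" if "y \<in> topspace B" for y
    using that comp_ge_surj[OF b' f emb] unfolding s_def
    by (auto intro: inv_into_into f_inv_into_f)
  \<comment> \<open>An arbitrary section suffices: \<open>F\<close> is continuous whatever \<open>s\<close> is, and equivariance of
    \<open>f\<close> makes it correct on the image of \<open>G\<close>.\<close>
  define F where "F p = (\<lambda>y\<in>topspace B. f (p (s y)))" for p
  have cont: "continuous_map (self_map_topology (gspace b'G)) P F"
  proof (rule continuous_map_into_self_map_topology)
    fix y assume y: "y \<in> topspace B"
    from continuous_map_compose[OF continuous_map_self_map_eval[OF s(1)[OF y]] f]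
    show "continuous_map (self_map_topology (gspace b'G)) B (\<lambda>p. F p y)"
      using y by (simp add: F_def o_def)
  qed (simp add: F_def)
  \<comment> \<open>Pointwise, \<open>f\<close> sends \<open>g\<close> acting on \<open>s y\<close>
    to \<open>g\<close> acting on \<open>f (s y)\<close>, and \<open>f (s y) = y\<close>.\<close>
  have F_emb: "F (ellis_emb b'G g) = \<iota> g" if "g \<in> carrier G" for g
    using that s
    by (auto simp: F_def ellis_emb_def comp_ge_equivariant[OF b' f emb] intro!: restrict_ext)
  have "F ` (self_map_topology (gspace b'G) closure_of (ellis_emb b'G ` carrier G)) \<subseteq> E"
    using closedin_ellis_set
    by (intro continuous_map_closure_subset[OF cont]) (auto simp: F_emb ellis_emb_in_ellis_set)
  then have "continuous_map (gspace (ellis_map G b'G)) (gspace (ellis_map G bG)) F"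
    using cont
    by (auto simp: ellis_map_sel b'.ellis_map_sel continuous_map_in_subtopology
        continuous_map_from_subtopology simp flip: ellis_set_def)
  then show ?thesis
    unfolding comp_ge_def using F_emb by (auto simp: ellis_map_sel b'.ellis_map_sel)
qed

section \<open>Ellis compactifications are fixed by the Ellis map\<close>

lemma Ellis_compactification_ge_ellis_map:
  assumes "Ellis_compactification G T bG"
  shows "comp_ge G bG (ellis_map G bG)"
proof -
  obtain S :: "'c monoid" where S: "right_topological_monoid S B"
    and act: "\<And>g x. \<lbrakk>g \<in> carrier G; x \<in> topspace B\<rbrakk> \<Longrightarrow> gemb bG g \<otimes>\<^bsub>S\<^esub> x = gact bG g x"
    using assms unfolding Ellis_compactification_def by blast
  define \<Phi> where "\<Phi> s = (\<lambda>x\<in>topspace B. s \<otimes>\<^bsub>S\<^esub> x)" for s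
  have cont: "continuous_map B P \<Phi>"
    using S
    by (intro continuous_map_into_self_map_topology)
      (auto simp: \<Phi>_def right_topological_monoid_def)
  have \<Phi>_emb: "\<Phi> (gemb bG g) = \<iota> g" if "g \<in> carrier G" for g
    using that by (auto simp: \<Phi>_def ellis_emb_def act)
  \<comment> \<open>By density the closure on the left is all of \<open>B\<close>, so
    \<open>\<Phi>\<close> maps the whole compactification into \<open>E\<close>.\<close>
  have "\<Phi> ` (B closure_of (gemb bG ` carrier G)) \<subseteq> E"
    using closedin_ellis_set
    by (intro continuous_map_closure_subset[OF cont]) (auto simp: \<Phi>_emb ellis_emb_in_ellis_set)
  then have "continuous_map B (gspace (ellis_map G bG)) \<Phi>"
    using cont by (auto simp: ellis_map_sel continuous_map_in_subtopology dense_emb)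
  then show ?thesis
    unfolding comp_ge_def using \<Phi>_emb by (auto simp: ellis_map_sel)
qed

end

text \<open>Needed at two types of points: surjectivity applies it to a given Ellis
  compactification, idempotence to \<open>ellis_map G bG\<close>, whose points are
  functions.\<close>

lemma Ellis_compactification_comp_eq_ellis_map:
  assumes "topological_group G T" and "Ellis_compactification G T eG"
  shows "comp_eq G (ellis_map G eG) eG"
proof -
  interpret topological_group G T by fact
  interpret G_compactified_group G T eG
    using assms(2) by unfold_locales (simp add: Ellis_compactification_def)
  show ?thesis
    unfolding comp_eq_def
    using ellis_map_ge Ellis_compactification_ge_ellis_map[OF assms(2)] by blast
qed

theorem theorem4p3:
  fixes G :: "('a, 'm) monoid_scheme" and T :: "'a topology"
  assumes "topological_group G T" and "tychonoff_space T"
  shows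
    "(\<forall>bG :: ('a, 'b) gcomp. G_compactification G T bG \<longrightarrow>
        Ellis_compactification G T (ellis_map G bG)) \<and>
     (\<forall>(b'G :: ('a, 'c) gcomp) (bG :: ('a, 'b) gcomp).
        G_compactification G T b'G \<longrightarrow> G_compactification G T bG \<longrightarrow> comp_ge G b'G bG \<longrightarrow>
        comp_ge G (ellis_map G b'G) (ellis_map G bG)) \<and>
     (\<forall>eG :: ('a, 'b) gcomp. Ellis_compactification G T eG \<longrightarrow>
        (\<exists>bG :: ('a, 'b) gcomp. G_compactification G T bG \<and> comp_eq G (ellis_map G bG) eG)) \<and>
     (\<forall>bG :: ('a, 'b) gcomp. G_compactification G T bG \<longrightarrow>
        comp_ge G (ellis_map G bG) bG) \<and>
     (\<forall>bG :: ('a, 'b) gcomp. G_compactification G T bG \<longrightarrow>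
        comp_eq G (ellis_map G (ellis_map G bG)) (ellis_map G bG))"
proof -
  interpret topological_group G T by fact
  show ?thesis
  proof (intro conjI allI impI)
    fix bG :: "('a, 'b) gcomp" assume "G_compactification G T bG"
    then interpret G_compactified_group G T bG
      by unfold_locales
    show "Ellis_compactification G T (ellis_map G bG)"
      by (rule ellis_map_Ellis_compactification)
    then show "comp_eq G (ellis_map G (ellis_map G bG)) (ellis_map G bG)"
      by (rule Ellis_compactification_comp_eq_ellis_map[OF assms(1)])
    show "comp_ge G (ellis_map G bG) bG"
      by (rule ellis_map_ge)
    fix b'G :: "('a, 'c) gcomp"
    assume "G_compactification G T b'G" "comp_ge G b'G bG"
    then show "comp_ge G (ellis_map G b'G) (ellis_map G bG)"
      by (rule ellis_map_mono)
  next
    fix eG :: "('a, 'b) gcomp" assume "Ellis_compactification G T eG"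
    \<comment> \<open>The preimage of \<open>eG\<close> is \<open>eG\<close> itself.\<close>
    then show "\<exists>bG :: ('a, 'b) gcomp. G_compactification G T bG \<and> comp_eq G (ellis_map G bG) eG"
      using Ellis_compactification_comp_eq_ellis_map[OF assms(1)] Ellis_compactification_def
      by blast
  qed
qed

end
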